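(* Let $n\ge 1$ be an integer, $\kappa>0$, let $C\subseteq \mathbb{H}^n_\kappa$ be a closed $\kappa$-hyperbolically convex set, $p\in\mathbb{H}^n_\kappa$ and $v\in C$. Then the following statements hold: (i) $v=P^\kappa_C(p)$ if and only if $-\kappa\langle p,v\rangle v\in\Lambda_{K_C}(p)\setminus\{0\}$. (ii) $\Lambda_{K_C}(p)\setminus\{0\}\neq\varnothing$.
   Context: For $x,y\in\mathbb{R}^{n+1}$ the Lorentzian inner product is $\langle x,y\rangle:=x_1y_1+\dots+x_ny_n-x_{n+1}y_{n+1}$. The $\kappa$-hyperbolic space form is $\mathbb{H}^n_\kappa:=\{p\in\mathbb{R}^{n+1}:\langle p,p\rangle=-1/\kappa,\ p_{n+1}>0\}$, with intrinsic distance $d_\kappa(p,q):=\frac{1}{\sqrt\kappa}\operatorname{arcosh}(-\kappa\langle p,q\rangle)$. It is a Riemannian manifold with the metric induced by $\langle\cdot,\cdot\rangle$ on tangent spaces; any two distinct points are joined by a unique geodesic segment, and a set $C\subseteq\mathbb{H}^n_\kappa$ is called $\kappa$-hyperbolically convex if for all $p,q\in C$ the geodesic segment joining $p$ to $q$ is contained in $C$. For a nonempty closed $\kappa$-hyperbolically convex set $C$, the intrinsic $\kappa$-projection $P^\kappa_C(p)$ of $p\in\mathbb{H}^n_\kappa$ is the unique minimizer of $q\mapsto d_\kappa(p,q)$ over $q\in C$. The cone spanned by $C$ is $K_C:=\{tp: p\in C,\ t\in[0,+\infty)\}$; it is a convex cone when $C$ is $\kappa$-hyperbolically convex. For a convex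 set $K\subseteq\mathbb{R}^{n+1}$ and $x\in\mathbb{R}^{n+1}$, the set of Lorentz projections (L-projections) of $x$ into $K$ is $\Lambda_K(x):=\{y\in K:\langle x-y,z-y\rangle\le 0\ \text{for all } z\in K\}$. *)

theory Defs
  imports "HOL-Analysis.Analysis"
begin

text \<open>
  Euclidean space of dimension \<open>n + 1\<close> is the type \<open>(real ^ 'n) \<times> real\<close> with \<open>n = CARD('n)\<close>:
  the first component collects the coordinates \<open>1, \<dots>, n\<close>, the second one is the
  coordinate \<open>n + 1\<close>.
\<close>

type_synonym 'n lspace = "(real ^ 'n) \<times> real"

definition lorentz :: "'n::finite lspace \<Rightarrow> 'n lspace \<Rightarrow> real" where
  "lorentz x y = fst x \<bullet> fst y - snd x * snd y"

definition hyperbolic_space :: "real \<Rightarrow> 'n::finite lspace set" where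
  "hyperbolic_space \<kappa> = {p. lorentz p p = - 1 / \<kappa> \<and> snd p > 0}"

definition hyp_dist :: "real \<Rightarrow> 'n::finite lspace \<Rightarrow> 'n lspace \<Rightarrow> real" where
  "hyp_dist \<kappa> p q = 1 / sqrt \<kappa> * arcosh (- \<kappa> * lorentz p q)"

text \<open>The tangent space, at the point \<open>p\<close>, of the hyperbolic space containing \<open>p\<close>.\<close>

definition hyp_tangent :: "'n::finite lspace \<Rightarrow> 'n lspace set" where
  "hyp_tangent p = {w. lorentz p w = 0}"

text \<open>
  The covariant derivative of the induced metric is the tangential part of the derivative in
  the ambient space. Hence a curve in the hyperbolic space is a (Riemannian) geodesic iff its
  ambient acceleration is Lorentz-orthogonal to the tangent space at each of its points.
  At the end points of the parameter interval the derivatives are one-sided.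
\<close>

definition hyp_geodesic :: "real \<Rightarrow> (real \<Rightarrow> 'n::finite lspace) \<Rightarrow> bool" where
  "hyp_geodesic \<kappa> g \<longleftrightarrow>
     g ` {0..1} \<subseteq> hyperbolic_space \<kappa> \<and>
     (\<exists>g' g''. \<forall>t\<in>{0..1}.
        (g has_vector_derivative g' t) (at t within {0..1}) \<and>
        (g' has_vector_derivative g'' t) (at t within {0..1}) \<and>
        (\<forall>w\<in>hyp_tangent (g t). lorentz (g'' t) w = 0))"

text \<open>
  Any two points \<open>p\<close> and \<open>q\<close> of the hyperbolic space are joined by exactly one geodesic on
  \<open>{0..1}\<close> (the constant one if \<open>p = q\<close>), so the following set is the image of that geodesic.
\<close>

definition geodesic_segment :: "real \<Rightarrow> 'n::finite lspace \<Rightarrow> 'n lspace \<Rightarrow> 'n lspace set" where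
  "geodesic_segment \<kappa> p q =
     {g t | g t. hyp_geodesic \<kappa> g \<and> g 0 = p \<and> g 1 = q \<and> t \<in> {0..1}}"

definition hyp_convex :: "real \<Rightarrow> 'n::finite lspace set \<Rightarrow> bool" where
  "hyp_convex \<kappa> C \<longleftrightarrow>
     C \<subseteq> hyperbolic_space \<kappa> \<and> (\<forall>p\<in>C. \<forall>q\<in>C. geodesic_segment \<kappa> p q \<subseteq> C)"

definition hyp_proj :: "real \<Rightarrow> 'n::finite lspace set \<Rightarrow> 'n lspace \<Rightarrow> 'n lspace" where
  "hyp_proj \<kappa> C p = (THE q. is_arg_min (hyp_dist \<kappa> p) (\<lambda>q. q \<in> C) q)"

definition cone_spanned :: "'n::finite lspace set \<Rightarrow> 'n lspace set" where
  "cone_spanned C = {t *\<^sub>R p | t p. p \<in> C \<and> t \<ge> 0}"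

definition lorentz_projections :: "'n::finite lspace set \<Rightarrow> 'n lspace \<Rightarrow> 'n lspace set" where
  "lorentz_projections K x = {y \<in> K. \<forall>z\<in>K. lorentz (x - y) (z - y) \<le> 0}"

end

theory Submission imports Defs begin

text \<open>
  Since \<open>-\<kappa>\<langle>p, v\<rangle> v\<close> is the Lorentz-orthogonal projection of \<open>p\<close> onto the line through \<open>v\<close>, it
  is an L-projection of \<open>p\<close> into the cone iff \<open>\<langle>p, q\<rangle> + \<kappa> \<langle>p, v\<rangle> \<langle>v, q\<rangle> \<le> 0\<close> for all \<open>q \<in> C\<close>.
  In terms of hyperbolic cosines of distances this reads \<open>cosh pq \<ge> cosh pv \<cdot> cosh vq\<close>, i.e. the
  angle at \<open>v\<close> is not acute. It makes \<open>v\<close> the strict minimizer of the distance to \<open>p\<close>; conversely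
  it is the first-order condition at a minimizer along the geodesic from \<open>v\<close> to \<open>q\<close>. A minimizer
  exists because sublevel sets of the distance are compact.
\<close>

section \<open>The Lorentzian inner product\<close>

lemma lorentz_commute: "lorentz x y = lorentz y x"
  by (simp add: lorentz_def inner_commute)

lemma lorentz_linear_simps:
  "lorentz (x + y) z = lorentz x z + lorentz y z"
  "lorentz z (x + y) = lorentz z x + lorentz z y"
  "lorentz (x - y) z = lorentz x z - lorentz y z"
  "lorentz z (x - y) = lorentz z x - lorentz z y"
  "lorentz (r *\<^sub>R x) z = r * lorentz x z"
  "lorentz z (r *\<^sub>R x) = r * lorentz z x"
  by (simp_all add: lorentz_def inner_add inner_diff algebra_simps)

lemma continuous_on_lorentz [continuous_intros]:
  "continuous_on S f \<Longrightarrow> continuous_on S g \<Longrightarrow> continuous_on S (\<lambda>x. lorentz (f x) (g x))"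
  unfolding lorentz_def by (intro continuous_intros)

text \<open>Solving the quadratic equation for the positive last coordinate gives a Euclidean norm.
  In this form closedness is evident, and Cauchy-Schwarz becomes applicable to the Lorentzian
  product.\<close>

lemma hyperbolic_space_iff:
  assumes "\<kappa> > 0"
  shows "p \<in> hyperbolic_space \<kappa> \<longleftrightarrow> snd p = norm (fst p, 1 / sqrt \<kappa>)"
proof -
  have "lorentz p p = (norm (fst p))\<^sup>2 - (snd p)\<^sup>2"
    by (simp add: lorentz_def power2_norm_eq_inner power2_eq_square[of "snd p"])
  moreover have "norm (fst p, 1 / sqrt \<kappa>) = sqrt ((norm (fst p))\<^sup>2 + 1 / \<kappa>)"
    using assms by (simp add: norm_Pair power_divide)
  moreover have "(norm (fst p))\<^sup>2 + 1 / \<kappa> > 0"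
    using assms by (simp add: add_nonneg_pos)
  ultimately show ?thesis
    by (auto simp: hyperbolic_space_def real_sqrt_unique intro!: real_sqrt_unique[symmetric])
qed

lemma lorentz_self_hyperbolic: "p \<in> hyperbolic_space \<kappa> \<Longrightarrow> lorentz p p = - 1 / \<kappa>"
  by (simp add: hyperbolic_space_def)

lemma closed_hyperbolic_space:
  assumes "\<kappa> > 0"
  shows "closed (hyperbolic_space \<kappa> :: 'n::finite lspace set)"
proof -
  have "hyperbolic_space \<kappa> = {p :: 'n lspace. snd p = norm (fst p, 1 / sqrt \<kappa>)}"
    using hyperbolic_space_iff[OF assms] by blast
  moreover have "closed {p :: 'n lspace. snd p = norm (fst p, 1 / sqrt \<kappa>)}"
    by (intro closed_Collect_eq continuous_intros)
  ultimately show ?thesis by simp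
qed

text \<open>On the hyperboloid, \<open>-\<langle>p, q\<rangle>\<close> and \<open>1 / \<kappa>\<close> differ by the Cauchy-Schwarz defect of the
  Euclidean vectors obtained from \<open>p\<close>, \<open>q\<close> by replacing the last coordinate with \<open>1 / sqrt \<kappa>\<close>.\<close>

lemma lorentz_hyperbolic:
  assumes "\<kappa> > 0" "p \<in> hyperbolic_space \<kappa>" "q \<in> hyperbolic_space \<kappa>"
  shows lorentz_hyperbolic_ge_1: "1 \<le> - \<kappa> * lorentz p q"
    and lorentz_hyperbolic_eq_1: "- \<kappa> * lorentz p q = 1 \<Longrightarrow> p = q"
proof -
  define u where "u = (fst p, 1 / sqrt \<kappa>)"
  define w where "w = (fst q, 1 / sqrt \<kappa>)"
  have sn: "snd p = norm u" "snd q = norm w"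
    using assms by (simp_all add: hyperbolic_space_iff u_def w_def)
  have inn: "u \<bullet> w = fst p \<bullet> fst q + 1 / \<kappa>"
    using assms(1) by (simp add: u_def w_def inner_prod_def)
  have eq: "- \<kappa> * lorentz p q = 1 + \<kappa> * (norm u * norm w - u \<bullet> w)"
    using assms(1) by (simp add: lorentz_def sn inn algebra_simps)
  show "1 \<le> - \<kappa> * lorentz p q"
    unfolding eq using assms(1) norm_cauchy_schwarz[of u w] by simp
  assume "- \<kappa> * lorentz p q = 1"
  hence "u \<bullet> w = norm u * norm w"
    using assms(1) unfolding eq by simp
  hence "norm u *\<^sub>R w = norm w *\<^sub>R u"
    by (simp add: norm_cauchy_schwarz_eq)
  hence "norm u *\<^sub>R fst w = norm w *\<^sub>R fst u" "norm u * snd w = norm w * snd u"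
    by (metis fst_scaleR, metis snd_scaleR real_scaleR_def)
  \<comment> \<open>The second components of \<open>u\<close> and \<open>w\<close> are the same
    nonzero number, so proportionality with the norms as factors forces equal norms.\<close>
  hence *: "norm u = norm w" "norm u *\<^sub>R fst q = norm w *\<^sub>R fst p"
    using assms(1) by (simp_all del: norm_Pair add: u_def w_def)
  moreover have "norm u > 0"
    using assms(1) by (simp add: u_def prod_eq_iff)
  ultimately have "fst p = fst q" by simp
  thus "p = q" using * sn by (simp add: prod_eq_iff)
qed

text \<open>\<open>arcosh\<close> is strictly increasing from 1 on, so minimizing the distance to
  \<open>p\<close> amounts to maximizing the function \<open>lorentz p\<close>, which is
  linear.\<close>

lemma hyp_dist_le_iff:
  assumes "\<kappa> > 0" "p \<in> hyperbolic_space \<kappa>" "q \<in> hyperbolic_space \<kappa>" "r \<in> hyperbolic_space \<kappa>"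
  shows "hyp_dist \<kappa> p q \<le> hyp_dist \<kappa> p r \<longleftrightarrow> lorentz p r \<le> lorentz p q"
proof -
  have "hyp_dist \<kappa> p q \<le> hyp_dist \<kappa> p r \<longleftrightarrow>
      arcosh (- \<kappa> * lorentz p q) \<le> arcosh (- \<kappa> * lorentz p r)"
    using assms(1) by (simp add: hyp_dist_def divide_le_cancel)
  also have "\<dots> \<longleftrightarrow> - \<kappa> * lorentz p q \<le> - \<kappa> * lorentz p r"
    unfolding linorder_not_less[symmetric]
    using arcosh_less_iff_real[OF lorentz_hyperbolic_ge_1[OF assms(1,2,4)]
        lorentz_hyperbolic_ge_1[OF assms(1,2,3)]] by (rule arg_cong)
  also have "\<dots> \<longleftrightarrow> lorentz p r \<le> lorentz p q"
    using assms(1) by simp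
  finally show ?thesis .
qed

section \<open>Geodesics\<close>

text \<open>The hyperbolic analogue of spherical linear interpolation, where \<open>d\<close> is
  \<open>sqrt \<kappa>\<close> times the distance of the end points. The acceleration is
  \<open>d^2\<close> times the position, hence Lorentz-orthogonal to the tangent space.\<close>

lemma hyp_geodesic_sinh:
  assumes \<kappa>: "\<kappa> > 0" and u: "u \<in> hyperbolic_space \<kappa>" and w: "w \<in> hyperbolic_space \<kappa>"
    and d: "d > 0" "cosh d = - \<kappa> * lorentz u w"
  shows "hyp_geodesic \<kappa>
    (\<lambda>t. (sinh ((1 - t) * d) / sinh d) *\<^sub>R u + (sinh (t * d) / sinh d) *\<^sub>R w)"
    (is "hyp_geodesic \<kappa> ?g")
proof -
  define h where
    "h t = (- d * cosh ((1 - t) * d) / sinh d) *\<^sub>R u + (d * cosh (t * d) / sinh d) *\<^sub>R w" for t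
  have sd: "sinh d > 0" using d by simp
  have uw: "lorentz u w = - cosh d / \<kappa>" using \<kappa> d by simp
  have on: "?g t \<in> hyperbolic_space \<kappa>" if t: "t \<in> {0..1}" for t
  proof -
    define S1 S2 where "S1 = sinh ((1 - t) * d)" and "S2 = sinh (t * d)"
    define C1 C2 where "C1 = cosh ((1 - t) * d)" and "C2 = cosh (t * d)"
    have c: "C1\<^sup>2 = S1\<^sup>2 + 1" "C2\<^sup>2 = S2\<^sup>2 + 1"
      by (simp_all add: S1_def S2_def C1_def C2_def cosh_square_eq)
    have dd: "d = (1 - t) * d + t * d" by (simp add: algebra_simps)
    have sh: "sinh d = S1 * C2 + C1 * S2"
      by (subst dd) (simp only: sinh_add S1_def S2_def C1_def C2_def)
    have ch: "cosh d = C1 * C2 + S1 * S2"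
      by (subst dd) (simp only: cosh_add S1_def S2_def C1_def C2_def)
    have "(sinh d)\<^sup>2 = S1\<^sup>2 * C2\<^sup>2 + C1\<^sup>2 * S2\<^sup>2 + 2 * S1 * S2 * (C1 * C2)"
      unfolding sh by (simp add: power2_eq_square algebra_simps)
    \<comment> \<open>Up to the factor \<open>- 1 / (\<kappa> * (sinh d)^2)\<close>, the left side
      is the Lorentz square of the point on the curve.\<close>
    hence key: "S1\<^sup>2 + S2\<^sup>2 + 2 * S1 * S2 * cosh d = (sinh d)\<^sup>2"
      unfolding ch c by (simp add: power2_eq_square algebra_simps)
    have "lorentz (?g t) (?g t) = - (S1\<^sup>2 + S2\<^sup>2 + 2 * S1 * S2 * cosh d) / (\<kappa> * (sinh d)\<^sup>2)"
      using \<kappa> sd lorentz_commute[of w u]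
      by (simp add: lorentz_linear_simps lorentz_self_hyperbolic[OF u]
          lorentz_self_hyperbolic[OF w] uw flip: S1_def S2_def)
        (simp add: field_simps power2_eq_square)
    hence "lorentz (?g t) (?g t) = - 1 / \<kappa>"
      unfolding key using sd by simp
    moreover have "snd (?g t) > 0"
    proof -
      have pos: "snd u > 0" "snd w > 0" using u w by (auto simp: hyperbolic_space_def)
      have nn: "S1 \<ge> 0" "S2 \<ge> 0" using t d by (simp_all add: S1_def S2_def)
      have "S1 > 0 \<or> S2 > 0"
        using t d by (cases "t = 0") (simp_all add: S1_def S2_def)
      hence "S1 * snd u + S2 * snd w > 0"
        using pos nn by (auto intro: add_pos_nonneg add_nonneg_pos)
      thus ?thesis using sd
        by (simp flip: S1_def S2_def add_divide_distrib)
    qed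
    ultimately show ?thesis by (simp add: hyperbolic_space_def)
  qed
  have d1: "(?g has_vector_derivative h t) (at t within {0..1})" for t
    unfolding h_def using sd
    by (auto intro!: derivative_eq_intros simp: mult.commute)
  have d2: "(h has_vector_derivative d\<^sup>2 *\<^sub>R ?g t) (at t within {0..1})" for t
    unfolding h_def using sd
    by (auto intro!: derivative_eq_intros simp: power2_eq_square scaleR_add_right mult_ac)
  show ?thesis
    unfolding hyp_geodesic_def
  proof (rule conjI[OF _ exI[of _ h, OF exI[of _ "\<lambda>t. d\<^sup>2 *\<^sub>R ?g t"]]], goal_cases)
    case 1
    show "?g ` {0..1} \<subseteq> hyperbolic_space \<kappa>" using on by blast
  next
    case 2
    have "lorentz (d\<^sup>2 *\<^sub>R ?g t) x = 0" if "x \<in> hyp_tangent (?g t)" for t x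
      using that by (simp only: hyp_tangent_def mem_Collect_eq lorentz_linear_simps(5) mult_zero_right)
    thus ?case using d1 d2 by blast
  qed
qed

text \<open>\<open>geodesic_segment\<close> collects the points of every geodesic on
  \<open>{0..1}\<close> with the given end points, so exhibiting one geodesic suffices.\<close>

lemma hyp_convex_sinh_mem:
  assumes "\<kappa> > 0" "hyp_convex \<kappa> C" "u \<in> C" "w \<in> C" "d > 0" "cosh d = - \<kappa> * lorentz u w"
    and "t \<in> {0..1}"
  shows "(sinh ((1 - t) * d) / sinh d) *\<^sub>R u + (sinh (t * d) / sinh d) *\<^sub>R w \<in> C"
    (is "?g t \<in> C")
proof -
  have "C \<subseteq> hyperbolic_space \<kappa>" "geodesic_segment \<kappa> u w \<subseteq> C"
    using assms by (auto simp: hyp_convex_def)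
  moreover have "hyp_geodesic \<kappa> ?g"
    using hyp_geodesic_sinh assms calculation by blast
  moreover have "?g 0 = u" "?g 1 = w" using assms(5) by simp_all
  ultimately show ?thesis
    using assms(7) unfolding geodesic_segment_def by blast
qed

section \<open>Minimizers of the distance\<close>

lemma minimizer_obtuse:
  assumes \<kappa>: "\<kappa> > 0" and C: "hyp_convex \<kappa> C" and v: "v \<in> C" and q: "q \<in> C"
    and min: "\<And>r. r \<in> C \<Longrightarrow> lorentz p r \<le> lorentz p v"
  shows "lorentz p q + \<kappa> * lorentz p v * lorentz v q \<le> 0"
proof (cases "v = q")
  case True
  thus ?thesis
    using \<kappa> C v by (auto simp: hyp_convex_def lorentz_self_hyperbolic dest!: subsetD)
next
  case False
  have H: "v \<in> hyperbolic_space \<kappa>" "q \<in> hyperbolic_space \<kappa>"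
    using C v q by (auto simp: hyp_convex_def)
  define d where "d = arcosh (- \<kappa> * lorentz v q)"
  have gt: "- \<kappa> * lorentz v q > 1"
    using lorentz_hyperbolic[OF \<kappa> H] False by linarith
  hence d: "d > 0" "cosh d = - \<kappa> * lorentz v q"
    unfolding d_def by simp_all
  have sd: "sinh d > 0" using d by simp
  \<comment> \<open>\<open>sinh d\<close> times the value of \<open>lorentz p\<close> along the
    geodesic from \<open>v\<close> to \<open>q\<close>. The formula makes sense for all real
    \<open>t\<close>, so a two-sided derivative at 0 is available.\<close>
  define f where "f t = sinh ((1 - t) * d) * lorentz p v + sinh (t * d) * lorentz p q" for t
  define f' where "f' = d * (lorentz p q - cosh d * lorentz p v)"
  have "(f has_real_derivative f') (at 0)"
    unfolding f_def f'_def
    by (auto intro!: derivative_eq_intros simp: algebra_simps)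
  have "f t \<le> f 0" if "t \<in> {0..1}" for t
  proof -
    have "f t / sinh d \<le> lorentz p v"
      using min[OF hyp_convex_sinh_mem[OF \<kappa> C v q d that]]
      by (simp add: f_def lorentz_linear_simps add_divide_distrib)
    thus ?thesis using sd by (simp add: f_def field_simps)
  qed
  have "f' \<le> 0"
  proof (rule ccontr)
    assume "\<not> f' \<le> 0"
    then obtain e where e: "e > 0" "\<And>h. 0 < h \<Longrightarrow> h < e \<Longrightarrow> f 0 < f (0 + h)"
      using DERIV_pos_inc_right[OF \<open>(f has_real_derivative f') (at 0)\<close>] by auto
    \<comment> \<open>Small enough for the strict increase to the right of 0, yet still a parameter
      of the geodesic, where \<open>f\<close> cannot exceed \<open>f 0\<close>.\<close>
    define h where "h = min 1 (e / 2)"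
    have "0 < h" "h < e" "h \<in> {0..1}" using e(1) by (auto simp: h_def)
    thus False
      using e(2)[of h] \<open>\<And>t. t \<in> {0..1} \<Longrightarrow> f t \<le> f 0\<close>[of h] by simp
  qed
  thus ?thesis
    using d by (simp add: f'_def mult_le_0_iff mult_ac)
qed

text \<open>The hypothesis says cosh pq \<ge> cosh pv * cosh vq, and the last factor is at least 1.
  Equality of the outer terms makes that factor 1, which means that \<open>v\<close> and
  \<open>q\<close> coincide.\<close>

lemma obtuse_imp_minimizer:
  assumes \<kappa>: "\<kappa> > 0" and "p \<in> hyperbolic_space \<kappa>" "v \<in> hyperbolic_space \<kappa>"
    "q \<in> hyperbolic_space \<kappa>"
    and obtuse: "lorentz p q + \<kappa> * lorentz p v * lorentz v q \<le> 0"
  shows "lorentz p q \<le> lorentz p v" and "lorentz p q = lorentz p v \<Longrightarrow> q = v"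
proof -
  define a where "a = - lorentz p v"
  define b where "b = - \<kappa> * lorentz v q"
  have "- \<kappa> * lorentz p v \<ge> 1"
    using assms by (intro lorentz_hyperbolic_ge_1)
  hence "\<kappa> * a > 0" by (simp add: a_def)
  hence a: "a > 0" using \<kappa> by (simp add: zero_less_mult_iff)
  have b: "b \<ge> 1"
    unfolding b_def using assms by (intro lorentz_hyperbolic_ge_1)
  have ab: "lorentz p q \<le> - (a * b)"
    using obtuse by (simp add: a_def b_def algebra_simps)
  show "lorentz p q \<le> lorentz p v"
    using ab mult_left_mono[OF b, of a] a unfolding a_def by linarith
  assume "lorentz p q = lorentz p v"
  hence "a * b \<le> a * 1" using ab by (simp add: a_def)
  hence "b = 1" using a b by simp
  thus "q = v"
    unfolding b_def using lorentz_hyperbolic_eq_1 assms by metis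
qed

lemma minimizer_exists:
  assumes \<kappa>: "\<kappa> > 0" and C: "closedin (top_of_set (hyperbolic_space \<kappa>)) C" "C \<noteq> {}"
    and p: "p \<in> hyperbolic_space \<kappa>"
  obtains v where "v \<in> C" "\<And>q. q \<in> C \<Longrightarrow> lorentz p q \<le> lorentz p v"
proof -
  obtain w where w: "w \<in> C" using C by blast
  \<comment> \<open>The part of \<open>C\<close> that is at most as far from \<open>p\<close> as
    \<open>w\<close>; it suffices to maximize there.\<close>
  define S where "S = C \<inter> {q. lorentz p w \<le> lorentz p q}"
  have CH: "C \<subseteq> hyperbolic_space \<kappa>"
    using closedin_imp_subset[OF C(1)] .
  have "closed C"
    using closedin_closed_trans[OF C(1) closed_hyperbolic_space[OF \<kappa>]] .
  hence "closed S"
    unfolding S_def by (intro closed_Int closed_Collect_le continuous_intros)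
  \<comment> \<open>Points of the hyperboloid lie strictly inside the future light cone.\<close>
  have gap: "snd q > norm (fst q)" if "q \<in> hyperbolic_space \<kappa>" for q :: "'a lspace"
  proof -
    have "(norm (fst q))\<^sup>2 < (norm (fst q))\<^sup>2 + (1 / sqrt \<kappa>)\<^sup>2"
      using \<kappa> by simp
    thus ?thesis
      using hyperbolic_space_iff[OF \<kappa>, of q] that by (simp add: norm_Pair real_less_rsqrt)
  qed
  \<comment> \<open>Cauchy-Schwarz gives
    \<open>- lorentz p q \<ge> (snd p - norm (fst p)) * snd q\<close>, with positive first factor by
    \<open>gap\<close>. So \<open>B\<close> bounds the last coordinate on \<open>S\<close>, and the
    other coordinates are dominated by it.\<close>
  define B where "B = - lorentz p w / (snd p - norm (fst p))"
  have bound: "norm q \<le> 2 * B" if "q \<in> S" for q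
  proof -
    have q: "q \<in> hyperbolic_space \<kappa>" "lorentz p w \<le> lorentz p q"
      using that CH by (auto simp: S_def)
    have "fst p \<bullet> fst q \<le> norm (fst p) * snd q"
      using norm_cauchy_schwarz[of "fst p" "fst q"] gap[OF q(1)]
        mult_left_mono[of "norm (fst q)" "snd q" "norm (fst p)"] by simp
    hence "(snd p - norm (fst p)) * snd q \<le> - lorentz p w"
      using q(2) by (simp add: lorentz_def algebra_simps)
    hence "snd q \<le> B"
      using gap[OF p] by (simp add: B_def field_simps)
    moreover have "norm q \<le> norm (fst q) + norm (snd q)"
      using norm_Pair_le[of "fst q" "snd q"] by simp
    moreover have "norm (snd q) = snd q"
      using q(1) by (simp add: hyperbolic_space_def)
    ultimately show ?thesis using gap[OF q(1)] by linarith
  qed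
  have "compact S"
    using \<open>closed S\<close> bound unfolding compact_eq_bounded_closed bounded_iff by blast
  moreover have "S \<noteq> {}" using w by (auto simp: S_def)
  moreover have "continuous_on S (lorentz p)" by (intro continuous_intros)
  ultimately obtain v where v: "v \<in> S" "\<And>q. q \<in> S \<Longrightarrow> lorentz p q \<le> lorentz p v"
    using continuous_attains_sup[of S "lorentz p"] by blast
  have "lorentz p q \<le> lorentz p v" if "q \<in> C" for q
    using v(2)[of q] v(1) that by (cases "q \<in> S") (auto simp: S_def)
  moreover have "v \<in> C" using v(1) by (simp add: S_def)
  ultimately show thesis using that by blast
qed

section \<open>Projections\<close>

text \<open>The residual of \<open>p\<close> is Lorentz-orthogonal to \<open>v\<close>, so testing
  against a point \<open>t *\<^sub>R q\<close> of the cone gives \<open>t\<close> times the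
  expression for \<open>q\<close>. The projection is nonzero because its coefficient is at least
  1.\<close>

lemma lorentz_projections_cone_iff:
  assumes \<kappa>: "\<kappa> > 0" and C: "C \<subseteq> hyperbolic_space \<kappa>" and p: "p \<in> hyperbolic_space \<kappa>"
    and v: "v \<in> C"
  shows "(- \<kappa> * lorentz p v) *\<^sub>R v \<in> lorentz_projections (cone_spanned C) p - {0} \<longleftrightarrow>
    (\<forall>q\<in>C. lorentz p q + \<kappa> * lorentz p v * lorentz v q \<le> 0)"
proof -
  define a where "a = - \<kappa> * lorentz p v"
  have vH: "v \<in> hyperbolic_space \<kappa>" using C v by blast
  have a: "a \<ge> 1"
    unfolding a_def using lorentz_hyperbolic_ge_1[OF \<kappa> p vH] .
  have "v \<noteq> 0" using vH by (auto simp: hyperbolic_space_def)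
  hence nz: "a *\<^sub>R v \<noteq> 0" using a by simp
  have mem: "a *\<^sub>R v \<in> cone_spanned C"
    using a v unfolding cone_spanned_def by (intro CollectI exI[of _ a] exI[of _ v]) simp
  have *: "lorentz (p - a *\<^sub>R v) (t *\<^sub>R q - a *\<^sub>R v) =
      t * (lorentz p q + \<kappa> * lorentz p v * lorentz v q)" for t q
    using \<kappa> by (simp add: lorentz_linear_simps lorentz_self_hyperbolic[OF vH])
      (simp add: a_def algebra_simps)
  have "(\<forall>z\<in>cone_spanned C. lorentz (p - a *\<^sub>R v) (z - a *\<^sub>R v) \<le> 0) \<longleftrightarrow>
      (\<forall>q\<in>C. \<forall>t\<ge>0. t * (lorentz p q + \<kappa> * lorentz p v * lorentz v q) \<le> 0)"
    unfolding cone_spanned_def *[symmetric] by blast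
  also have "\<dots> \<longleftrightarrow> (\<forall>q\<in>C. lorentz p q + \<kappa> * lorentz p v * lorentz v q \<le> 0)"
    by (metis mult_nonneg_nonpos mult_1 zero_le_one)
  finally show ?thesis
    using nz mem unfolding a_def[symmetric] by (simp add: lorentz_projections_def)
qed

theorem theorem14:
  fixes \<kappa> :: real and C :: "((real ^ 'n) \<times> real) set" and p v :: "(real ^ 'n) \<times> real"
  assumes "\<kappa> > 0"
    and "closedin (top_of_set (hyperbolic_space \<kappa>)) C"
    and "hyp_convex \<kappa> C"
    and "p \<in> hyperbolic_space \<kappa>"
    and "v \<in> C"
  shows "(v = hyp_proj \<kappa> C p \<longleftrightarrow>
            (- \<kappa> * lorentz p v) *\<^sub>R v \<in> lorentz_projections (cone_spanned C) p - {0}) \<and>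
         lorentz_projections (cone_spanned C) p - {0} \<noteq> {}"
proof -
  have CH: "C \<subseteq> hyperbolic_space \<kappa>"
    using assms(3) by (simp add: hyp_convex_def)
  have "C \<noteq> {}" using assms(5) by blast
  then obtain u where u: "u \<in> C" "\<And>q. q \<in> C \<Longrightarrow> lorentz p q \<le> lorentz p u"
    using minimizer_exists assms(1,2,4) by blast
  have obt: "lorentz p q + \<kappa> * lorentz p u * lorentz u q \<le> 0" if "q \<in> C" for q
    using minimizer_obtuse[OF assms(1,3) u(1) that u(2)] .
  have arg_min: "is_arg_min (hyp_dist \<kappa> p) (\<lambda>q. q \<in> C) w \<longleftrightarrow>
      w \<in> C \<and> (\<forall>q\<in>C. lorentz p q \<le> lorentz p w)" for w
    using hyp_dist_le_iff[OF assms(1,4)] CH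
    unfolding is_arg_min_linorder by (meson subsetD)
  \<comment> \<open>Both \<open>w\<close> and \<open>u\<close> attain the maximum of
    \<open>lorentz p\<close>, and the obtuse angle at \<open>u\<close> makes its maximizer
    unique.\<close>
  have uniq: "w = u" if "w \<in> C" "\<forall>q\<in>C. lorentz p q \<le> lorentz p w" for w
    using obtuse_imp_minimizer(2)[OF assms(1,4) _ _ obt[OF that(1)]] that u CH
    by (meson order_antisym subsetD)
  have proj: "hyp_proj \<kappa> C p = u"
    unfolding hyp_proj_def arg_min by (rule the_equality) (use u uniq in blast)+
  \<comment> \<open>Taking \<open>w = v\<close> yields the equivalence (i), and \<open>w = u\<close>
    provides the element required in (ii).\<close>
  have iff: "(- \<kappa> * lorentz p w) *\<^sub>R w \<in> lorentz_projections (cone_spanned C) p - {0} \<longleftrightarrow> w = u"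
    if "w \<in> C" for w
  proof
    assume "(- \<kappa> * lorentz p w) *\<^sub>R w \<in> lorentz_projections (cone_spanned C) p - {0}"
    hence "\<forall>q\<in>C. lorentz p q \<le> lorentz p w"
      using lorentz_projections_cone_iff[OF assms(1) CH assms(4) that]
        obtuse_imp_minimizer(1)[OF assms(1,4)] CH that by blast
    thus "w = u" using uniq that by blast
  next
    assume "w = u"
    thus "(- \<kappa> * lorentz p w) *\<^sub>R w \<in> lorentz_projections (cone_spanned C) p - {0}"
      using lorentz_projections_cone_iff[OF assms(1) CH assms(4) u(1)] obt by blast
  qed
  show ?thesis
    using iff[OF assms(5)] iff[OF u(1)] proj by blast
qed

end
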